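(* For all integers $n, j, r, t$ with $n, j\geq 0$, $r\geq 2$ and $1\leq t\leq r-1$, $$E_{j,r,t}(n)=(j+1)\,|\mathcal{O}_{j+1,r}(n)|-j\,|\mathcal{O}_{j,r}(n)|=(j+1)\,|\mathcal{D}_{j+1,r}(n)|-j\,|\mathcal{D}_{j,r}(n)|,$$ where $$E_{j,r,t}(n)=\sum_{\lambda\in \mathcal{O}_{j,r}(n)}\bigl(\ell_t(\lambda)-\ell_0(\lambda)\bigr)-\sum_{\lambda\in \mathcal{D}_{j,r}(n)}\bar{\ell}_t(\lambda).$$
   Context: A partition $\lambda$ of a non-negative integer $n$ is a non-increasing finite sequence of positive integers (its parts) with sum $n$; the empty partition is the only partition of $0$. For integers $j\ge 0$, $r\ge 2$, $n \ge 0$: - $\mathcal{O}_{j,r}(n)$ is the set of partitions of $n$ with exactly $j$ different parts divisible by $r$. Here different means distinct part values; these parts may be repeated. - $\mathcal{D}_{j,r}(n)$ is the set of partitions of $n$ in which exactly $j$ different parts are repeated at least $r$ times (i.e. have multiplicity at least $r$), all other parts appearing at most $r-1$ times. Fix $r\ge 2$. For $0\leq t\leq r-1$, $\ell_t(\lambda)$ denotes the number of parts of $\lambda$, counted with multiplicity, that are congruent to $t$ modulo $r$ (so $\ell_0(\lambda)$ is the number of parts divisible by $r$). If $i$ is a part of $\lambda$ with multiplicity $s_i$, the residual multiplicity of $i$ in $\lambda$ is the remainder of $s_i$ on division by $r$, an element of $\{0,1,\ldots,r-1\}$. $\bar{\ell}_t(\lambda)$ denotes the number of different parts (distinct part values)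 of $\lambda$ whose residual multiplicity is at least $t$. All differences are taken in $\mathbb{Z}$ (they may be negative). *)

theory Defs
  imports "HOL-Library.Multiset" "HOL-Number_Theory.Cong"
begin

text \<open>A partition is represented by the multiset of its parts.\<close>

definition partitions :: "nat \<Rightarrow> nat multiset set" where
  "partitions n = {p. 0 \<notin># p \<and> sum_mset p = n}"

definition O_set :: "nat \<Rightarrow> nat \<Rightarrow> nat \<Rightarrow> nat multiset set" where
  "O_set j r n = {p \<in> partitions n. card {i \<in> set_mset p. r dvd i} = j}"

definition D_set :: "nat \<Rightarrow> nat \<Rightarrow> nat \<Rightarrow> nat multiset set" where
  "D_set j r n = {p \<in> partitions n. card {i \<in> set_mset p. count p i \<ge> r} = j}"

definition ell :: "nat \<Rightarrow> nat \<Rightarrow> nat multiset \<Rightarrow> nat" where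
  "ell r t p = size {#i \<in># p. [i = t] (mod r)#}"

definition residual_mult :: "nat \<Rightarrow> nat multiset \<Rightarrow> nat \<Rightarrow> nat" where
  "residual_mult r p i = count p i mod r"

definition ell_bar :: "nat \<Rightarrow> nat \<Rightarrow> nat multiset \<Rightarrow> nat" where
  "ell_bar r t p = card {i \<in> set_mset p. residual_mult r p i \<ge> t}"

definition E :: "nat \<Rightarrow> nat \<Rightarrow> nat \<Rightarrow> nat \<Rightarrow> int" where
  "E j r t n =
     (\<Sum>p\<in>O_set j r n. int (ell r t p) - int (ell r 0 p))
     - (\<Sum>p\<in>D_set j r n. int (ell_bar r t p))"

text \<open>Finiteness makes the cardinalities and sums above genuine ones.\<close>

lemma finite_partitions: "finite (partitions n)"
proof -
  have "p \<in> mset ` {xs. set xs \<subseteq> {..n} \<and> length xs \<le> n}" if "p \<in> partitions n" for p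
  proof -
    obtain xs where xs: "p = mset xs" using ex_mset by metis
    have nz: "0 \<notin> set xs" and s: "sum_list xs = n"
      using that by (auto simp: partitions_def xs sum_mset_sum_list)
    have "length xs \<le> sum_list xs" using nz by (induction xs) auto
    moreover have "set xs \<subseteq> {..n}" using s member_le_sum_list by fastforce
    ultimately show ?thesis using xs s by auto
  qed
  then have "partitions n \<subseteq> mset ` {xs. set xs \<subseteq> {..n} \<and> length xs \<le> n}" by blast
  then show ?thesis
    by (rule finite_subset) (intro finite_imageI finite_lists_length_le finite_atMost)
qed

lemma finite_O_set: "finite (O_set j r n)" and finite_D_set: "finite (D_set j r n)"
  using finite_partitions by (simp_all add: O_set_def D_set_def)

end

theory Submission
  imports Defs "HOL-Library.FuncSet"
begin

text \<open>
  Everything is obtained by removing copies of a part from a partition and asking when the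
  removal respects the classes \<open>O_set j r\<close> and \<open>D_set j r\<close>. Write \<open>N d\<close> for the number
  of partitions of \<open>n - d\<close> with exactly \<open>j\<close> different parts divisible by \<open>r\<close>.

  \<^item> The sets \<open>O_set j r n\<close> and \<open>D_set j r n\<close> are equinumerous. For a finite set \<open>S\<close> of positive
    integers, the partitions containing all \<open>r * i\<close> with \<open>i \<in> S\<close>, and those in which all
    \<open>i \<in> S\<close> occur at least \<open>r\<close> times, both correspond to arbitrary partitions of
    \<open>n - r * \<Sum>S\<close>. Two families of properties with equal intersection numbers have equally many
    objects with exactly \<open>j\<close> properties. So \<open>N\<close> also counts by frequent parts.

  \<^item> Removing \<open>m\<close> copies of a part not divisible by \<open>r\<close> leaves the number of divisible parts
    alone, so the sum of \<open>ell r t\<close> over \<open>O_set j r n\<close> is the sum of \<open>N (m * (t + r * a))\<close> over all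
    \<open>m \<ge> 1\<close> and \<open>a \<ge> 0\<close>.

  \<^item> Removing \<open>t\<close> copies of a part with residual multiplicity at least \<open>t\<close> leaves the number
    of frequent parts alone, and turns ``residual multiplicity at least \<open>t\<close>'' into
    ``less than \<open>r - t\<close>''. Iterating this, the sum of \<open>ell_bar r t\<close> over
    \<open>D_set j r n\<close> is the sum of \<open>N (i * (t + r * m)) - N (i * (r + r * m))\<close> over \<open>i \<ge> 1\<close> and
    \<open>m \<ge> 0\<close>. The first terms are those of the previous item.

  \<^item> What remains of \<open>E j r t n\<close> is the sum of \<open>N (m * b)\<close>, minus the number of
    partitions in \<open>O_set j r n\<close> with at least \<open>m\<close> copies of \<open>b\<close>, over the positive multiples \<open>b\<close> of \<open>r\<close>
    and \<open>m \<ge> 1\<close>. Adding \<open>m\<close> copies of \<open>b\<close> to a partition counted by \<open>N (m * b)\<close> stays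
    in class \<open>j\<close> if \<open>b\<close> is already a part and moves to class \<open>j + 1\<close> otherwise
    (lemma \<open>divisible_part_exchange\<close>). The difference therefore counts
    multiplicities exactly \<open>m\<close> in class \<open>j + 1\<close> minus those in class \<open>j\<close>; summed over \<open>m\<close> and \<open>b\<close>,
    each partition is counted once per divisible part, hence \<open>j + 1\<close> times and \<open>j\<close> times.
\<close>

section \<open>Removing parts from partitions\<close>

text \<open>The partitions of \<open>n - d\<close>, except that there are none when \<open>d > n\<close>. With truncated
  subtraction, \<open>partitions (n - d)\<close> would contain the empty partition in that case and the
  removal bijections would fail.\<close>

definition partitions_diff :: "nat \<Rightarrow> nat \<Rightarrow> nat multiset set" where
  "partitions_diff n d = {p. 0 \<notin># p \<and> sum_mset p + d = n}"

abbreviation num_divisible :: "nat \<Rightarrow> nat multiset \<Rightarrow> nat" where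
  "num_divisible r p \<equiv> card {i \<in> set_mset p. r dvd i}"

abbreviation num_frequent :: "nat \<Rightarrow> nat multiset \<Rightarrow> nat" where
  "num_frequent r p \<equiv> card {i \<in> set_mset p. count p i \<ge> r}"

lemma partitions_diff_0: "partitions_diff n 0 = partitions n"
  by (simp add: partitions_diff_def partitions_def)

lemma finite_partitions_diff: "finite (partitions_diff n d)"
  by (rule finite_subset[OF _ finite_partitions[of "n - d"]])
     (auto simp: partitions_diff_def partitions_def)

lemma partitions_diff_empty: "n < d \<Longrightarrow> partitions_diff n d = {}"
  by (auto simp: partitions_diff_def)

lemma O_set_alt: "O_set j r n = {p \<in> partitions_diff n 0. num_divisible r p = j}"
  by (simp add: O_set_def partitions_diff_0)

lemma D_set_alt: "D_set j r n = {p \<in> partitions_diff n 0. num_frequent r p = j}"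
  by (simp add: D_set_def partitions_diff_0)

lemma count_le_sum_mset:
  fixes p :: "nat multiset"
  assumes "i \<ge> 1"
  shows "count p i \<le> sum_mset p"
  using assms by (induction p) auto

lemma part_in_range:
  assumes "p \<in> partitions_diff n d" "i \<in># p"
  shows "1 \<le> i" "i \<le> n"
proof -
  obtain q where "p = add_mset i q" using multi_member_split[OF assms(2)] by blast
  then show "i \<le> n" using assms(1) by (auto simp: partitions_diff_def)
  show "1 \<le> i" using assms by (cases i) (auto simp: partitions_diff_def)
qed

text \<open>The common form of all bijections below: taking \<open>M\<close> away and putting it back. The
  predicate \<open>Q\<close> speaks about the partition that is left.\<close>

lemma card_remove_multiset:
  assumes "0 \<notin># M"
  shows "card {p \<in> partitions_diff n d. M \<subseteq># p \<and> Q (p - M)}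
       = card {p \<in> partitions_diff n (d + sum_mset M). Q p}"
proof (rule bij_betw_same_card)
  show "bij_betw (\<lambda>p. p - M) {p \<in> partitions_diff n d. M \<subseteq># p \<and> Q (p - M)}
      {p \<in> partitions_diff n (d + sum_mset M). Q p}"
  proof (rule bij_betwI[where g = "\<lambda>p. p + M"])
    show "(\<lambda>p. p - M) \<in> {p \<in> partitions_diff n d. M \<subseteq># p \<and> Q (p - M)}
        \<rightarrow> {p \<in> partitions_diff n (d + sum_mset M). Q p}"
    proof
      fix p assume p: "p \<in> {p \<in> partitions_diff n d. M \<subseteq># p \<and> Q (p - M)}"
      then obtain q where "p = M + q" by (auto simp: mset_subset_eq_exists_conv)
      with p show "p - M \<in> {p \<in> partitions_diff n (d + sum_mset M). Q p}"
        by (auto simp: partitions_diff_def)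
    qed
  qed (use assms in \<open>auto simp: partitions_diff_def\<close>)
qed

lemma card_remove_copies:
  assumes "i \<ge> 1"
  shows "card {p \<in> partitions_diff n d. m \<le> count p i \<and> Q (p - replicate_mset m i)}
       = card {p \<in> partitions_diff n (d + m * i). Q p}"
  using card_remove_multiset[of "replicate_mset m i" n d Q] assms
  by (simp add: count_le_replicate_mset_subset_eq mult.commute)

lemma card_filter_split:
  assumes "finite X"
  shows "card {x \<in> X. P x} = card {x \<in> X. P x \<and> Q x} + card {x \<in> X. P x \<and> \<not> Q x}"
proof -
  have "{x \<in> X. P x} = {x \<in> X. P x \<and> Q x} \<union> {x \<in> X. P x \<and> \<not> Q x}" by auto
  then show ?thesis using assms by (simp add: card_Un_disjoint disjoint_iff)
qed

lemma sum_card_swap: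
  assumes "finite X" "finite Y"
  shows "(\<Sum>x\<in>X. card {y \<in> Y. R x y}) = (\<Sum>y\<in>Y. card {x \<in> X. R x y})"
  using sum.swap_restrict[OF assms, of "\<lambda>_ _. 1::nat" R] by simp

section \<open>Equinumerosity by sieving\<close>

text \<open>Both sides count pairs of an object and a \<open>k\<close>-set of properties that it has.\<close>

lemma sum_binomial_properties:
  assumes "finite X" "finite I"
  shows "(\<Sum>x\<in>X. card {i \<in> I. A i x} choose k)
       = (\<Sum>S | S \<subseteq> I \<and> card S = k. card {x \<in> X. \<forall>i\<in>S. A i x})"
proof -
  have "(card {i \<in> I. A i x} choose k)
      = card {S \<in> {S. S \<subseteq> I \<and> card S = k}. \<forall>i\<in>S. A i x}" for x
  proof -
    have "{S \<in> {S. S \<subseteq> I \<and> card S = k}. \<forall>i\<in>S. A i x}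
        = {S. S \<subseteq> {i \<in> I. A i x} \<and> card S = k}" by auto
    then show ?thesis using n_subsets[of "{i \<in> I. A i x}" k] assms by simp
  qed
  then show ?thesis
    using assms sum_card_swap[of X "{S. S \<subseteq> I \<and> card S = k}" "\<lambda>x S. \<forall>i\<in>S. A i x"]
    by simp
qed

text \<open>The system is triangular with ones on the diagonal, so it is solved from the top index
  downwards.\<close>

lemma binomial_transform_inj:
  fixes a b :: "nat \<Rightarrow> nat"
  assumes eq: "\<And>k. (\<Sum>i\<le>N. a i * (i choose k)) = (\<Sum>i\<le>N. b i * (i choose k))"
    and "j \<le> N"
  shows "a j = b j"
  using \<open>j \<le> N\<close>
proof (induction "N - j" arbitrary: j rule: less_induct)
  case less
  have split: "(\<Sum>i\<le>N. c i * (i choose j)) = c j + (\<Sum>i\<in>{j<..N}. c i * (i choose j))"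
    for c :: "nat \<Rightarrow> nat"
  proof -
    have "(\<Sum>i\<le>N. c i * (i choose j)) = (\<Sum>i\<in>{j..N}. c i * (i choose j))"
      by (rule sum.mono_neutral_right) (auto simp: binomial_eq_0)
    also have "{j..N} = insert j {j<..N}" using less.prems by auto
    finally show ?thesis by simp
  qed
  have "(\<Sum>i\<in>{j<..N}. a i * (i choose j)) = (\<Sum>i\<in>{j<..N}. b i * (i choose j))"
    using less.hyps by (intro sum.cong) auto
  then show ?case using eq[of j] by (simp add: split)
qed

text \<open>The intersection numbers determine the binomial moments of the number of properties, and
  these determine its distribution.\<close>

lemma sieve_equivalent_families:
  assumes fin: "finite X" "finite I"
    and eq: "\<And>S. S \<subseteq> I \<Longrightarrow> card {x \<in> X. \<forall>i\<in>S. A i x} = card {x \<in> X. \<forall>i\<in>S. B i x}"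
  shows "card {x \<in> X. card {i \<in> I. A i x} = j} = card {x \<in> X. card {i \<in> I. B i x} = j}"
proof -
  define num where "num C j = card {x \<in> X. card {i \<in> I. C i x} = j}" for C j
  have le: "card {i \<in> I. C i x} \<le> card I" for C x
    using fin by (intro card_mono) auto
  have expand: "(\<Sum>i\<le>card I. num C i * (i choose k)) = (\<Sum>x\<in>X. card {i \<in> I. C i x} choose k)"
    for C k
  proof -
    have "(\<Sum>x\<in>X. card {i \<in> I. C i x} choose k)
        = (\<Sum>j\<le>card I. \<Sum>x | x \<in> X \<and> card {i \<in> I. C i x} = j. card {i \<in> I. C i x} choose k)"
      using fin le by (intro sum.group[symmetric]) auto
    also have "\<dots> = (\<Sum>j\<le>card I. num C j * (j choose k))"
      by (intro sum.cong) (auto simp: num_def)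
    finally show ?thesis ..
  qed
  have "(\<Sum>i\<le>card I. num A i * (i choose k)) = (\<Sum>i\<le>card I. num B i * (i choose k))" for k
    unfolding expand sum_binomial_properties[OF fin] using eq by (intro sum.cong) auto
  then have "num A j = num B j" if "j \<le> card I"
    using binomial_transform_inj that by blast
  moreover have "num A j = num B j" if "\<not> j \<le> card I"
  proof -
    have "num C j = 0" for C
    proof -
      have "card {i \<in> I. C i x} \<noteq> j" for x using le[of C x] that by linarith
      then show ?thesis by (simp add: num_def)
    qed
    then show ?thesis by simp
  qed
  ultimately show ?thesis unfolding num_def by blast
qed

text \<open>Both statistics count, over the same index range \<open>{1..n}\<close>, how many of a family of
  properties hold; a divisible part \<open>r * i\<close> is indexed by \<open>i\<close>.\<close>

lemma num_divisible_conv: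
  assumes "p \<in> partitions_diff n d" "r \<ge> 1"
  shows "num_divisible r p = card {i \<in> {1..n}. r * i \<in># p}"
proof -
  have "{i \<in> set_mset p. r dvd i} = (*) r ` {i \<in> {1..n}. r * i \<in># p}"
  proof (intro equalityI subsetI)
    fix b assume b: "b \<in> {i \<in> set_mset p. r dvd i}"
    then obtain i where i: "b = r * i" by blast
    have "1 \<le> r * i" "r * i \<le> n" using part_in_range[OF assms(1), of b] b i by blast+
    moreover from this have "i \<le> n" using assms(2) by (intro order.trans[of i "r * i" n]) auto
    ultimately have "i \<in> {1..n}" by (cases "i = 0") auto
    then show "b \<in> (*) r ` {i \<in> {1..n}. r * i \<in># p}" using b i by blast
  qed auto
  then show ?thesis using assms(2) by (simp add: card_image inj_on_def)
qed

lemma num_frequent_conv: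
  assumes "p \<in> partitions_diff n d" "r \<ge> 1"
  shows "num_frequent r p = card {i \<in> {1..n}. r \<le> count p i}"
proof -
  have "{i \<in> set_mset p. r \<le> count p i} = {i \<in> {1..n}. r \<le> count p i}"
    using part_in_range[OF assms(1)] assms(2)
    by (auto simp: count_greater_zero_iff[symmetric] simp del: count_greater_zero_iff)
  then show ?thesis by simp
qed

text \<open>One copy of \<open>r * i\<close> and \<open>r\<close> copies of \<open>i\<close> weigh the same, so demanding either for all
  \<open>i \<in> S\<close> removes the same amount from \<open>n\<close>.\<close>

lemma card_divisible_eq_card_frequent:
  assumes "r \<ge> 1"
  shows "card {p \<in> partitions_diff n d. num_divisible r p = j}
       = card {p \<in> partitions_diff n d. num_frequent r p = j}"
proof -
  have "card {p \<in> partitions_diff n d. \<forall>i\<in>S. r * i \<in># p}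
      = card {p \<in> partitions_diff n d. \<forall>i\<in>S. r \<le> count p i}" if S: "S \<subseteq> {1..n}" for S
  proof -
    have fin: "finite S" and pos: "0 \<notin> S" using S finite_subset by auto
    define M where "M = mset_set ((*) r ` S)"
    define M' where "M' = repeat_mset r (mset_set S)"
    have sums: "sum_mset M = sum_mset M'"
    proof -
      have "sum_mset M = \<Sum>((*) r ` S)" by (simp add: M_def sum_unfold_sum_mset)
      also have "\<dots> = (\<Sum>i\<in>S. r * i)" using assms by (subst sum.reindex) (auto simp: inj_on_def)
      also have "\<dots> = sum_mset M'"
        unfolding M'_def by (induction r) (simp_all add: sum_unfold_sum_mset sum_mset.distrib)
      finally show ?thesis .
    qed
    have M: "M \<subseteq># p \<longleftrightarrow> (\<forall>i\<in>S. r * i \<in># p)" for p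
      using fin by (auto simp: M_def subseteq_mset_def count_mset_set' Suc_le_eq)
    have M': "M' \<subseteq># p \<longleftrightarrow> (\<forall>i\<in>S. r \<le> count p i)" for p
      using fin by (auto simp: M'_def subseteq_mset_def count_mset_set')
    have "0 \<notin># M" "0 \<notin># M'"
      using pos fin assms by (auto simp: M_def M'_def not_in_iff count_mset_set')
    then show ?thesis
      using card_remove_multiset[of M n d "\<lambda>_. True"] card_remove_multiset[of M' n d "\<lambda>_. True"]
      by (simp add: sums M M')
  qed
  then have "card {p \<in> partitions_diff n d. card {i \<in> {1..n}. r * i \<in># p} = j}
      = card {p \<in> partitions_diff n d. card {i \<in> {1..n}. r \<le> count p i} = j}"
    by (intro sieve_equivalent_families finite_partitions_diff) auto
  moreover have "{p \<in> partitions_diff n d. num_divisible r p = j}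
      = {p \<in> partitions_diff n d. card {i \<in> {1..n}. r * i \<in># p} = j}"
    using num_divisible_conv assms by auto
  moreover have "{p \<in> partitions_diff n d. num_frequent r p = j}
      = {p \<in> partitions_diff n d. card {i \<in> {1..n}. r \<le> count p i} = j}"
    using num_frequent_conv assms by auto
  ultimately show ?thesis by simp
qed

section \<open>Parts in a residue class\<close>

text \<open>Residue classes are represented by \<open>t \<in> {1..r}\<close>, with \<open>r\<close> in the role of \<open>0\<close>: then
  the positive members of the class are exactly \<open>t + r * a\<close>, also for the multiples of \<open>r\<close>.\<close>

lemma cong_offset_iff:
  fixes r t b :: nat
  assumes "1 \<le> t" "t \<le> r" "1 \<le> b"
  shows "[b = t] (mod r) \<longleftrightarrow> (\<exists>a. b = t + r * a)"
proof
  assume c: "[b = t] (mod r)"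
  have "t \<le> b"
  proof (rule ccontr)
    assume "\<not> t \<le> b"
    then have "r dvd t - b" using c by (metis cong_altdef_nat' cong_diff_iff_cong_0_nat
      cong_sym cong_0_iff nat_le_linear)
    moreover have "0 < t - b" "t - b < r" using \<open>\<not> t \<le> b\<close> assms by auto
    ultimately show False using nat_dvd_not_less by blast
  qed
  then show "\<exists>a. b = t + r * a" using c cong_le_nat[of t b r]
    by (auto simp: cong_sym_eq mult.commute)
qed (auto simp: cong_def)

lemma ell_eq_sum_count:
  assumes p: "p \<in> partitions_diff n 0" and t: "1 \<le> t" "t \<le> r"
  shows "ell r t p = (\<Sum>a<n. count p (t + r * a))"
proof -
  let ?F = "{i \<in> set_mset p. [i = t] (mod r)}"
  have "ell r t p = (\<Sum>i\<in>?F. count p i)"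
    by (simp add: ell_def size_multiset_overloaded_eq)
  also have "\<dots> = (\<Sum>i\<in>(\<lambda>a. t + r * a) ` {..<n}. count p i)"
  proof (rule sum.mono_neutral_left)
    show "?F \<subseteq> (\<lambda>a. t + r * a) ` {..<n}"
    proof
      fix i assume i: "i \<in> ?F"
      then obtain a where a: "i = t + r * a"
        using cong_offset_iff t part_in_range[OF p] by blast
      have "a \<le> r * a" using t by simp
      moreover have "t + r * a \<le> n" using part_in_range(2)[OF p] i a by blast
      ultimately have "a < n" using t by linarith
      with a show "i \<in> (\<lambda>a. t + r * a) ` {..<n}" by blast
    qed
    show "\<forall>i\<in>(\<lambda>a. t + r * a) ` {..<n} - ?F. count p i = 0"
      using t by (auto simp: cong_def not_in_iff)
  qed simp
  also have "\<dots> = (\<Sum>a<n. count p (t + r * a))"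
    using t by (subst sum.reindex) (auto simp: inj_on_def)
  finally show ?thesis .
qed

text \<open>The multiplicity of a part is the number of \<open>m \<ge> 1\<close> not exceeding it.\<close>

lemma sum_ell_eq:
  assumes t: "1 \<le> t" "t \<le> r"
  shows "(\<Sum>p\<in>O_set j r n. ell r t p)
       = (\<Sum>a<n. \<Sum>m\<in>{1..n}. card {p \<in> O_set j r n. m \<le> count p (t + r * a)})"
proof -
  have "(\<Sum>p\<in>O_set j r n. ell r t p) = (\<Sum>p\<in>O_set j r n. \<Sum>a<n. count p (t + r * a))"
    using ell_eq_sum_count t by (intro sum.cong) (auto simp: O_set_alt)
  also have "\<dots> = (\<Sum>a<n. \<Sum>p\<in>O_set j r n. card {m \<in> {1..n}. m \<le> count p (t + r * a)})"
  proof (subst sum.swap, intro sum.cong refl)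
    fix a p assume "p \<in> O_set j r n"
    then have "count p (t + r * a) \<le> n"
      using count_le_sum_mset[of "t + r * a" p] t by (auto simp: O_set_alt partitions_diff_def)
    then have "{m \<in> {1..n}. m \<le> count p (t + r * a)} = {1..count p (t + r * a)}" by auto
    then show "count p (t + r * a) = card {m \<in> {1..n}. m \<le> count p (t + r * a)}" by simp
  qed
  also have "\<dots> = (\<Sum>a<n. \<Sum>m\<in>{1..n}. card {p \<in> O_set j r n. m \<le> count p (t + r * a)})"
    by (intro sum.cong refl sum_card_swap finite_O_set) auto
  finally show ?thesis .
qed

lemma card_remove_nondivisible:
  assumes "\<not> r dvd b"
  shows "card {p \<in> O_set j r n. m \<le> count p b}
       = card {p \<in> partitions_diff n (m * b). num_divisible r p = j}"
proof -
  have "{i \<in> set_mset (p - replicate_mset m b). r dvd i} = {i \<in> set_mset p. r dvd i}" for p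
    using assms by (auto simp: in_diff_count dest: in_diffD split: if_splits)
  then have "{p \<in> O_set j r n. m \<le> count p b}
      = {p \<in> partitions_diff n 0. m \<le> count p b \<and> num_divisible r (p - replicate_mset m b) = j}"
    by (auto simp: O_set_alt)
  moreover have "b \<ge> 1" using assms by (cases b) auto
  ultimately show ?thesis
    using card_remove_copies[of b n 0 m "\<lambda>p. num_divisible r p = j"] by simp
qed

section \<open>Residual multiplicities\<close>

text \<open>Removing at most the residual multiplicity does not change the quotient of the
  multiplicity by \<open>r\<close>, and a part is frequent iff this quotient is positive.\<close>

lemma num_frequent_remove_residual:
  assumes "m \<le> count p i mod r" "r \<ge> 1"
  shows "num_frequent r (p - replicate_mset m i) = num_frequent r p"
proof -
  have "r \<le> count p i - m \<longleftrightarrow> r \<le> count p i"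
  proof
    assume "r \<le> count p i"
    then have "r * 1 \<le> r * (count p i div r)" using assms(2)
      by (metis div_greater_zero_iff mult_le_mono2 Suc_leI One_nat_def less_eq_Suc_le)
    also have "\<dots> = count p i - count p i mod r" by (simp add: minus_mod_eq_mult_div)
    also have "\<dots> \<le> count p i - m" using assms(1) by simp
    finally show "r \<le> count p i - m" by simp
  qed auto
  then have "{k \<in> set_mset (p - replicate_mset m i). r \<le> count (p - replicate_mset m i) k}
      = {k \<in> set_mset p. r \<le> count p k}"
    using assms(2)
    by (auto simp: count_greater_zero_iff[symmetric] simp del: count_greater_zero_iff split: if_splits)
  then show ?thesis by simp
qed

text \<open>Removing \<open>t\<close> copies of \<open>i\<close> maps the residual multiplicities \<open>t, \<dots>, r - 1\<close> onto
  \<open>0, \<dots>, r - 1 - t\<close>.\<close>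

lemma card_residual_ge:
  assumes i: "i \<ge> 1" and t: "t < r"
  shows "card {p \<in> partitions_diff n d. num_frequent r p = j \<and> t \<le> count p i mod r}
       = card {p \<in> partitions_diff n (d + t * i). num_frequent r p = j \<and> count p i mod r < r - t}"
proof -
  let ?Q = "\<lambda>p. num_frequent r p = j \<and> count p i mod r < r - t"
  have "num_frequent r p = j \<and> t \<le> count p i mod r \<longleftrightarrow>
      t \<le> count p i \<and> ?Q (p - replicate_mset t i)" for p
  proof -
    have "t \<le> count p i mod r \<longleftrightarrow> t \<le> count p i \<and> (count p i - t) mod r < r - t"
    proof
      assume h: "t \<le> count p i mod r"
      have "count p i - t = r * (count p i div r) + (count p i mod r - t)"
        using h by (metis add_diff_assoc mult_div_mod_eq)
      moreover have "count p i mod r - t < r - t" using h t by (simp add: diff_less_mono)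
      ultimately have "(count p i - t) mod r = count p i mod r - t"
        by (simp add: mod_less)
      then show "t \<le> count p i \<and> (count p i - t) mod r < r - t"
        using h \<open>count p i mod r - t < r - t\<close> by (metis le_trans mod_less_eq_dividend)
    next
      assume h: "t \<le> count p i \<and> (count p i - t) mod r < r - t"
      then have "((count p i - t) + t) mod r = (count p i - t) mod r + t"
        by (metis add.commute less_diff_conv mod_add_left_eq mod_less)
      then show "t \<le> count p i mod r" using h by simp
    qed
    moreover have "count (p - replicate_mset t i) i = count p i - t" by simp
    moreover have "num_frequent r (p - replicate_mset t i) = num_frequent r p"
      if "t \<le> count p i mod r"
      using num_frequent_remove_residual that t by simp
    ultimately show ?thesis by (cases "t \<le> count p i mod r") (simp_all only:, simp_all)
  qed
  then show ?thesis using card_remove_copies[OF i, of n d t ?Q] by simp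
qed

text \<open>The preceding lemma, applied with \<open>t\<close> and then to the complement with \<open>r - t\<close>; the two
  removals together take away \<open>r\<close> copies of \<open>i\<close>.\<close>

lemma card_residual_ge_step:
  assumes i: "i \<ge> 1" and t: "1 \<le> t" "t < r"
  shows "int (card {p \<in> partitions_diff n d. num_frequent r p = j \<and> t \<le> count p i mod r})
       = int (card {p \<in> partitions_diff n (d + t * i). num_frequent r p = j})
         - int (card {p \<in> partitions_diff n (d + r * i). num_frequent r p = j})
         + int (card {p \<in> partitions_diff n (d + r * i). num_frequent r p = j \<and> t \<le> count p i mod r})"
proof -
  have compl: "card {p \<in> partitions_diff n e. num_frequent r p = j}
      = card {p \<in> partitions_diff n e. num_frequent r p = j \<and> s \<le> count p i mod r}
      + card {p \<in> partitions_diff n e. num_frequent r p = j \<and> count p i mod r < s}" for e s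
    using card_filter_split[OF finite_partitions_diff,
        of n e "\<lambda>p. num_frequent r p = j" "\<lambda>p. s \<le> count p i mod r"]
    by (simp add: not_le)
  have e: "d + t * i + (r - t) * i = d + r * i"
    using t by (simp add: add.assoc flip: add_mult_distrib)
  show ?thesis
    using card_residual_ge[OF i, of t r n d j] card_residual_ge[OF i, of "r - t" r n "d + t * i" j]
      compl[of "d + t * i" "r - t"] compl[of "d + r * i" t] t
    by (simp add: e)
qed

lemma card_residual_ge_sum:
  assumes i: "i \<ge> 1" and t: "1 \<le> t" "t < r"
  shows "int (card {p \<in> partitions_diff n 0. num_frequent r p = j \<and> t \<le> count p i mod r})
       = (\<Sum>m<k. int (card {p \<in> partitions_diff n (i * (t + r * m)). num_frequent r p = j})
                - int (card {p \<in> partitions_diff n (i * (r + r * m)). num_frequent r p = j}))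
         + int (card {p \<in> partitions_diff n (i * (r * k)). num_frequent r p = j \<and> t \<le> count p i mod r})"
proof (induction k)
  case (Suc k)
  have "i * (r * k) + t * i = i * (t + r * k)" "i * (r * k) + r * i = i * (r + r * k)"
    by (simp_all add: algebra_simps)
  with Suc card_residual_ge_step[OF assms, of n "i * (r * k)" j] show ?case by simp
qed simp

lemma sum_ell_bar_eq:
  assumes t: "1 \<le> t" "t < r"
  shows "int (\<Sum>p\<in>D_set j r n. ell_bar r t p)
       = (\<Sum>i\<in>{1..n}. \<Sum>m<n.
            int (card {p \<in> partitions_diff n (i * (t + r * m)). num_frequent r p = j})
          - int (card {p \<in> partitions_diff n (i * (r + r * m)). num_frequent r p = j}))"
proof -
  have "(\<Sum>p\<in>D_set j r n. ell_bar r t p)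
      = (\<Sum>p\<in>D_set j r n. card {i \<in> {1..n}. t \<le> count p i mod r})"
  proof (intro sum.cong refl)
    fix p assume "p \<in> D_set j r n"
    then have p: "p \<in> partitions_diff n 0" by (simp add: D_set_alt)
    have "{i \<in> set_mset p. t \<le> residual_mult r p i} = {i \<in> {1..n}. t \<le> count p i mod r}"
      using part_in_range[OF p] t
      by (auto simp: residual_mult_def not_in_iff intro: ccontr)
    then show "ell_bar r t p = card {i \<in> {1..n}. t \<le> count p i mod r}"
      by (simp add: ell_bar_def)
  qed
  also have "\<dots> = (\<Sum>i\<in>{1..n}. card {p \<in> D_set j r n. t \<le> count p i mod r})"
    by (intro sum_card_swap finite_D_set) auto
  finally have "int (\<Sum>p\<in>D_set j r n. ell_bar r t p)
      = (\<Sum>i\<in>{1..n}. int (card {p \<in> partitions_diff n 0. num_frequent r p = j \<and> t \<le> count p i mod r}))"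
    by (simp add: D_set_alt conj_assoc)
  also have "\<dots> = (\<Sum>i\<in>{1..n}. \<Sum>m<n.
            int (card {p \<in> partitions_diff n (i * (t + r * m)). num_frequent r p = j})
          - int (card {p \<in> partitions_diff n (i * (r + r * m)). num_frequent r p = j}))"
  proof (intro sum.cong refl)
    fix i assume i: "i \<in> {1..n}"
    have "2 * n \<le> r * n" "1 * (r * n) \<le> i * (r * n)"
      using i t by (intro mult_le_mono; simp)+
    \<comment> \<open>After \<open>n\<close> steps more than \<open>n\<close> would have been removed, so the remainder term vanishes.\<close>
    then have "n < i * (r * n)" using i unfolding atLeastAtMost_iff by linarith
    then show "int (card {p \<in> partitions_diff n 0. num_frequent r p = j \<and> t \<le> count p i mod r})
      = (\<Sum>m<n. int (card {p \<in> partitions_diff n (i * (t + r * m)). num_frequent r p = j})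
          - int (card {p \<in> partitions_diff n (i * (r + r * m)). num_frequent r p = j}))"
      using card_residual_ge_sum[of i t r n j n] i t by (simp add: partitions_diff_empty)
  qed
  finally show ?thesis .
qed

section \<open>Parts divisible by the modulus\<close>

text \<open>Add \<open>m\<close> copies of \<open>b\<close> to a partition with \<open>j\<close> divisible parts. If \<open>b\<close> was a part, the
  result has \<open>j\<close> divisible parts and more than \<open>m\<close> copies of \<open>b\<close>; otherwise it has \<open>j + 1\<close>
  divisible parts and exactly \<open>m\<close> copies of \<open>b\<close>.\<close>

lemma divisible_part_exchange:
  assumes b: "r dvd b" "b \<ge> 1" and m: "m \<ge> 1"
  shows "int (card {p \<in> partitions_diff n (m * b). num_divisible r p = j})
         - int (card {p \<in> O_set j r n. m \<le> count p b})
       = int (card {p \<in> O_set (j + 1) r n. count p b = m})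
         - int (card {p \<in> O_set j r n. count p b = m})"
proof -
  have keep: "card {p \<in> O_set j r n. m < count p b}
      = card {p \<in> partitions_diff n (m * b). num_divisible r p = j \<and> b \<in># p}"
  proof -
    have mem: "b \<in># p - replicate_mset m b \<longleftrightarrow> m < count p b" for p
      by (simp add: in_diff_count)
    have "{i \<in> set_mset (p - replicate_mset m b). r dvd i} = {i \<in> set_mset p. r dvd i}"
      if "m < count p b" for p
      using that count_inI[of p b] by (auto simp: in_diff_count dest: in_diffD split: if_splits)
    then have "num_divisible r (p - replicate_mset m b) = num_divisible r p"
      if "m < count p b" for p
      using that by simp
    then have "{p \<in> O_set j r n. m < count p b}
        = {p \<in> partitions_diff n 0. m \<le> count p b \<and>
            (num_divisible r (p - replicate_mset m b) = j \<and> b \<in># p - replicate_mset m b)}"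
      unfolding O_set_alt mem by auto
    then show ?thesis
      using card_remove_copies[OF b(2), of n 0 m "\<lambda>p. num_divisible r p = j \<and> b \<in># p"] by simp
  qed
  have lose: "card {p \<in> O_set (j + 1) r n. count p b = m}
      = card {p \<in> partitions_diff n (m * b). num_divisible r p = j \<and> b \<notin># p}"
  proof -
    have "num_divisible r p = Suc (num_divisible r (p - replicate_mset m b))"
      if "count p b = m" for p
    proof -
      have "{i \<in> set_mset p. r dvd i}
          = insert b {i \<in> set_mset (p - replicate_mset m b). r dvd i}"
        using that b m by (auto simp: in_diff_count dest: in_diffD split: if_splits)
      moreover have "b \<notin># p - replicate_mset m b" using that by (simp add: in_diff_count)
      ultimately show ?thesis by simp
    qed
    then have "{p \<in> O_set (j + 1) r n. count p b = m}
        = {p \<in> partitions_diff n 0. m \<le> count p b \<and>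
            (num_divisible r (p - replicate_mset m b) = j \<and> b \<notin># p - replicate_mset m b)}"
      by (auto simp: O_set_alt in_diff_count)
    then show ?thesis
      using card_remove_copies[OF b(2), of n 0 m "\<lambda>p. num_divisible r p = j \<and> b \<notin># p"] by simp
  qed
  have "card {p \<in> O_set j r n. m \<le> count p b}
      = card {p \<in> O_set j r n. m < count p b} + card {p \<in> O_set j r n. count p b = m}"
  proof -
    have "{p \<in> O_set j r n. m \<le> count p b}
        = {p \<in> O_set j r n. m < count p b} \<union> {p \<in> O_set j r n. count p b = m}" by auto
    then show ?thesis by (simp add: card_Un_disjoint finite_O_set disjoint_iff)
  qed
  then show ?thesis
    using keep lose card_filter_split[OF finite_partitions_diff,
        of n "m * b" "\<lambda>p. num_divisible r p = j" "\<lambda>p. b \<in># p"]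
    by simp
qed

text \<open>Every divisible part of a partition has exactly one multiplicity, so it is counted
  once.\<close>

lemma sum_divisible_parts:
  assumes "r \<ge> 1"
  shows "(\<Sum>a<n. \<Sum>m\<in>{1..n}. card {p \<in> O_set j r n. count p (r + r * a) = m})
       = j * card (O_set j r n)"
proof -
  have "(\<Sum>m\<in>{1..n}. card {p \<in> O_set j r n. count p (r + r * a) = m})
      = card {p \<in> O_set j r n. r * Suc a \<in># p}" for a
  proof -
    have "card {p \<in> O_set j r n. r * Suc a \<in># p}
        = card (\<Union>m\<in>{1..n}. {p \<in> O_set j r n. count p (r + r * a) = m})"
    proof (intro arg_cong[where f = card] equalityI subsetI)
      fix p assume p: "p \<in> {p \<in> O_set j r n. r * Suc a \<in># p}"
      then have "count p (r * Suc a) \<le> n" using count_le_sum_mset[of "r * Suc a" p] assms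
        by (auto simp: O_set_def partitions_def)
      moreover have "1 \<le> count p (r * Suc a)" using p by (simp add: Suc_le_eq)
      ultimately show "p \<in> (\<Union>m\<in>{1..n}. {p \<in> O_set j r n. count p (r + r * a) = m})"
        using p by auto
    qed (auto simp: count_greater_zero_iff[symmetric] simp del: count_greater_zero_iff)
    also have "\<dots> = (\<Sum>m\<in>{1..n}. card {p \<in> O_set j r n. count p (r + r * a) = m})"
      by (rule card_UN_disjoint) (auto simp: finite_O_set)
    finally show ?thesis ..
  qed
  then have "(\<Sum>a<n. \<Sum>m\<in>{1..n}. card {p \<in> O_set j r n. count p (r + r * a) = m})
      = (\<Sum>a<n. card {p \<in> O_set j r n. r * Suc a \<in># p})" by simp
  also have "\<dots> = (\<Sum>i\<in>{1..n}. card {p \<in> O_set j r n. r * i \<in># p})"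
    by (rule sum.reindex_bij_witness[where i = "\<lambda>i. i - 1" and j = Suc]) auto
  also have "\<dots> = (\<Sum>p\<in>O_set j r n. card {i \<in> {1..n}. r * i \<in># p})"
    by (intro sum_card_swap[symmetric] finite_O_set) auto
  also have "\<dots> = (\<Sum>p\<in>O_set j r n. j)"
    using num_divisible_conv assms by (intro sum.cong) (auto simp: O_set_alt)
  finally show ?thesis by simp
qed

theorem theorem4:
  fixes n j r t :: nat
  assumes "r \<ge> 2" and "1 \<le> t" and "t \<le> r - 1"
  shows "E j r t n = (int j + 1) * int (card (O_set (j + 1) r n)) - int j * int (card (O_set j r n))
    \<and> (int j + 1) * int (card (O_set (j + 1) r n)) - int j * int (card (O_set j r n))
      = (int j + 1) * int (card (D_set (j + 1) r n)) - int j * int (card (D_set j r n))"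
proof
  have t: "1 \<le> t" "t < r" using assms by auto
  have OD: "card (O_set k r n) = card (D_set k r n)" for k
    using card_divisible_eq_card_frequent[of r n 0 k] assms by (simp add: O_set_alt D_set_alt)
  then show "(int j + 1) * int (card (O_set (j + 1) r n)) - int j * int (card (O_set j r n))
      = (int j + 1) * int (card (D_set (j + 1) r n)) - int j * int (card (D_set j r n))"
    by simp
  define N where "N d = int (card {p \<in> partitions_diff n d. num_divisible r p = j})" for d
  have N_frequent: "int (card {p \<in> partitions_diff n d. num_frequent r p = j}) = N d" for d
    using card_divisible_eq_card_frequent[of r n d j] assms by (simp add: N_def)
  have nd: "\<not> r dvd t + r * a" for a
    using t by (simp add: dvd_add_left_iff nat_dvd_not_less)
  have ell_t: "int (\<Sum>p\<in>O_set j r n. ell r t p) = (\<Sum>a<n. \<Sum>m\<in>{1..n}. N (m * (t + r * a)))"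
    using t by (simp add: sum_ell_eq card_remove_nondivisible[OF nd] N_def)
  have ell_bar_t: "int (\<Sum>p\<in>D_set j r n. ell_bar r t p)
      = (\<Sum>a<n. \<Sum>m\<in>{1..n}. N (m * (t + r * a)) - N (m * (r + r * a)))"
    unfolding sum_ell_bar_eq[OF t] N_frequent by (rule sum.swap)
  \<comment> \<open>Represent the class of the multiples of \<open>r\<close> by \<open>r\<close>, so that \<open>sum_ell_eq\<close> applies.\<close>
  have "ell r 0 p = ell r r p" for p by (simp add: ell_def cong_def)
  then have ell_0: "int (\<Sum>p\<in>O_set j r n. ell r 0 p)
      = (\<Sum>a<n. \<Sum>m\<in>{1..n}. int (card {p \<in> O_set j r n. m \<le> count p (r + r * a)}))"
    using sum_ell_eq[of r r j n] assms by simp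
  have "E j r t n = int (\<Sum>p\<in>O_set j r n. ell r t p) - int (\<Sum>p\<in>D_set j r n. ell_bar r t p)
      - int (\<Sum>p\<in>O_set j r n. ell r 0 p)"
    by (simp add: E_def sum_subtractf)
  \<comment> \<open>The terms \<open>N (m * (t + r * a))\<close> cancel.\<close>
  also have "\<dots> = (\<Sum>a<n. \<Sum>m\<in>{1..n}.
      N (m * (r + r * a)) - int (card {p \<in> O_set j r n. m \<le> count p (r + r * a)}))"
    unfolding ell_t ell_bar_t ell_0 by (simp add: sum_subtractf)
  also have "\<dots> = (\<Sum>a<n. \<Sum>m\<in>{1..n}. int (card {p \<in> O_set (j + 1) r n. count p (r + r * a) = m})
      - int (card {p \<in> O_set j r n. count p (r + r * a) = m}))"
    unfolding N_def using assms by (intro sum.cong refl divisible_part_exchange) auto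
  also have "\<dots> = int (\<Sum>a<n. \<Sum>m\<in>{1..n}. card {p \<in> O_set (j + 1) r n. count p (r + r * a) = m})
      - int (\<Sum>a<n. \<Sum>m\<in>{1..n}. card {p \<in> O_set j r n. count p (r + r * a) = m})"
    by (simp add: sum_subtractf)
  also have "\<dots> = (int j + 1) * int (card (O_set (j + 1) r n)) - int j * int (card (O_set j r n))"
    using assms by (subst (1 2) sum_divisible_parts) (auto simp: algebra_simps)
  finally show "E j r t n
      = (int j + 1) * int (card (O_set (j + 1) r n)) - int j * int (card (O_set j r n))" .
qed

end
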